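(* For any knot $K$ and any fields $\mathbb{F}$ and $\mathbb{F}'$, $$|s_{\mathbb{F}}(K)-s_{\mathbb{F}'}(K)|\leq 2\lambda(K),$$ where $\lambda(K)=\lambda(K,U;\mathbb{Z})$ with $U$ the unknot.
   Context: Knots are smooth knots in $S^3$. Gradings. $\mathbb{Z}[G]$ is the polynomial ring in one variable, with quantum grading $q(1)=0$, $q(G)=-2$. Complexes are bigraded; differentials raise the homological degree by $1$ and preserve the quantum degree. $q^\ell$ denotes the quantum shift $(q^\ell M)_i=M_{i-\ell}$ and $t^j$ the homological shift. The complex $\mathrm{CBN}(K)$. It is, up to chain homotopy equivalence of graded complexes of free $\mathbb{Z}[G]$-modules, the reduced Khovanov complex for the Frobenius algebra $A=\mathbb{Z}[G][X]/(X^2+GX)$. Concretely: take an oriented diagram $D$ of $K$ with $n_\pm$ positive/negative crossings and a basepoint away from the crossings. To a vertex $v$ of the cube of resolutions (Khovanov's conventions for $0$- and $1$-smoothings) assign the tensor product over $\mathbb{Z}[G]$ of one copy of $A$ for each circle without basepoint ($1$ in degree $+1$, $X$ in degree $-1$) and $A/(X)\cong\mathbb{Z}[G]$ (generator $1$ in degree $0$) for the circle with basepoint, placed in homological degree $|v|-n_-$ and shifted in quantum degree by $|v|+n_+-2n_-$. Edge maps are, up to the usual signs, induced by multiplication $m$ (merge) and by $\Delta(1)=1\otimes X+X\otimes 1+G\,1\otimes 1$, $\Delta(X)=X\otimes X$ (split). For the unknot, $\mathrm{CBN}(U)\simeq t^0q^0\mathbb{Z}[G]$. Rasmussen invariant.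 For a field $\mathbb{F}$, $\mathrm{CBN}(K)\otimes_{\mathbb{Z}[G]}\mathbb{F}[G]$ is homotopy equivalent to $t^0q^{s}\mathbb{F}[G]$ plus summands $t^iq^\ell\mathbb{F}[G]\xrightarrow{G^k}t^{i+1}q^{2k+\ell}\mathbb{F}[G]$ with $k\geq1$; $s_{\mathbb{F}}(K)=s\in2\mathbb{Z}$ is the Rasmussen invariant over $\mathbb{F}$. Chain maps are $\mathbb{Z}[G]$-linear, commute with differentials and preserve the homological grading; a chain map $f$ is homogeneous of quantum degree $q(f)$ if it shifts quantum degree by $q(f)$; $\simeq$ between maps is chain homotopy. Definition. $\lambda(K,J;\mathbb{Z})$ is the minimal integer $n\ge 0$ such that there exist homogeneous chain maps $f\colon\mathrm{CBN}(K)\to\mathrm{CBN}(J)$ and $g\colon\mathrm{CBN}(J)\to\mathrm{CBN}(K)$ with $f\circ g\simeq G^n\cdot\mathrm{id}$ and $g\circ f\simeq G^n\cdot\mathrm{id}$ ($\min\varnothing=\infty$). *)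

theory Defs
  imports
    "HOL-Analysis.Analysis"
    "HOL-Computational_Algebra.Polynomial"
    "HOL-Library.Extended_Nat"
begin

section \<open>Smooth knots and their diagrams\<close>

definition smooth_curve :: "(real \<Rightarrow> 'a::real_normed_vector) \<Rightarrow> bool" where
  "smooth_curve c \<longleftrightarrow>
     (\<forall>k t. ((\<lambda>f t. vector_derivative f (at t)) ^^ k) c differentiable (at t))"

text \<open>An oriented smooth knot in the unit sphere of \<open>\<real>\<^sup>4\<close>, given by a 1-periodic parametrisation.\<close>

definition smooth_knot :: "(real \<Rightarrow> real^4) \<Rightarrow> bool" where
  "smooth_knot K \<longleftrightarrow>
     smooth_curve K \<and> (\<forall>t. norm (K t) = 1) \<and> (\<forall>t. K (t + 1) = K t) \<and>
     inj_on K {0..<1} \<and> (\<forall>t. vector_derivative K (at t) \<noteq> 0)"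

text \<open>
  A based oriented diagram with \<open>n\<close> crossings is recorded by its signed Gauss code. Starting at the
  basepoint and following the orientation, one passes through crossings \<open>2n\<close> times, at positions
  \<open>0, \<dots>, 2n-1\<close>. The list has one entry \<open>(p, r, \<epsilon>)\<close> per crossing: \<open>p\<close> is the
  position of the overpass, \<open>r\<close> that of the underpass, and \<open>\<epsilon>\<close> is true iff the crossing is
  positive. The order of the list is the order of the crossings used for the signs in the cube.
\<close>

type_synonym diagram = "(nat \<times> nat \<times> bool) list"

definition gauss_code :: "diagram \<Rightarrow> bool" where
  "gauss_code D \<longleftrightarrow>
     distinct (map fst D @ map (fst \<circ> snd) D) \<and>
     set (map fst D @ map (fst \<circ> snd) D) = {..<2 * length D}"

text \<open>
  Stereographic projection from the point \<open>y$4 = 1\<close> identifies its complement in the sphere with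
  \<open>\<real>\<^sup>3\<close>. The plane of the diagram is given by the first two coordinates and the third one is the
  height.
\<close>

definition planar_part :: "real^4 \<Rightarrow> complex" where
  "planar_part y = Complex (y $ 1 / (1 - y $ 4)) (y $ 2 / (1 - y $ 4))"

definition height :: "real^4 \<Rightarrow> real" where
  "height y = y $ 3 / (1 - y $ 4)"

text \<open>
  \<open>D\<close> is read off from a regular projection of \<open>K\<close>, after a rotation of the sphere. Here \<open>b\<close> is the
  parameter of the basepoint, \<open>\<tau> i\<close> is the time of the \<open>i\<close>-th passage through a crossing, and
  \<open>Im (cnj v * w)\<close> is the determinant of the plane vectors \<open>v, w\<close>. Since all positions in \<open>D\<close> are
  distinct, the double point condition excludes triple points.
\<close>

definition diagram_of :: "(real \<Rightarrow> real^4) \<Rightarrow> diagram \<Rightarrow> bool" where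
  "diagram_of K D \<longleftrightarrow> gauss_code D \<and>
     (\<exists>(R :: real^4^4) (b :: real) (\<tau> :: nat \<Rightarrow> real).
        rotation_matrix R \<and> (\<forall>t. (R *v K t) $ 4 \<noteq> 1) \<and>
        (let c = (\<lambda>t. planar_part (R *v K t));
             z = (\<lambda>t. height (R *v K t));
             c' = (\<lambda>t. vector_derivative c (at t))
         in (\<forall>t. c' t \<noteq> 0) \<and>
            strict_mono_on {..<2 * length D} \<tau> \<and>
            \<tau> ` {..<2 * length D} \<subseteq> {b<..<b + 1} \<and>
            (\<forall>x\<in>{b..<b + 1}. \<forall>y\<in>{b..<b + 1}. x \<noteq> y \<longrightarrow>
               (c x = c y \<longleftrightarrow> (\<exists>(p, r, \<epsilon>) \<in> set D. {x, y} = {\<tau> p, \<tau> r}))) \<and>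
            (\<forall>(p, r, \<epsilon>) \<in> set D. z (\<tau> p) > z (\<tau> r) \<and>
               (if \<epsilon> then Im (cnj (c' (\<tau> p)) * c' (\<tau> r)) > 0
                else Im (cnj (c' (\<tau> p)) * c' (\<tau> r)) < 0))))"


section \<open>Bigraded complexes of free modules over \<open>R[G]\<close>\<close>

text \<open>
  \<open>R[G]\<close> is \<open>R poly\<close>. A complex is given by a homogeneous basis and the matrix of the differential,
  and linear maps are given by matrices: \<open>f a b\<close> is the coefficient of \<open>b\<close> in the image of the basis
  element \<open>a\<close>. Only the entries at basis elements matter.
\<close>

record ('b, 'p) gcomplex =
  gens :: "'b set"
  hdeg :: "'b \<Rightarrow> int"
  qdeg :: "'b \<Rightarrow> int"
  dmat :: "'b \<Rightarrow> 'b \<Rightarrow> 'p"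

definition G :: "'r::comm_ring_1 poly" where
  "G = [:0, 1:]"

definition compose_on :: "'b set \<Rightarrow> ('b \<Rightarrow> 'c \<Rightarrow> 'r::comm_ring_1 poly) \<Rightarrow>
    ('a \<Rightarrow> 'b \<Rightarrow> 'r poly) \<Rightarrow> 'a \<Rightarrow> 'c \<Rightarrow> 'r poly" where
  "compose_on B g f = (\<lambda>a c. \<Sum>b\<in>B. f a b * g b c)"

definition scalar_mat :: "'r::comm_ring_1 poly \<Rightarrow> 'b \<Rightarrow> 'b \<Rightarrow> 'r poly" where
  "scalar_mat x = (\<lambda>a b. if a = b then x else 0)"

definition homological_degree ::
    "('b, 'r::comm_ring_1 poly) gcomplex \<Rightarrow> ('c, 'r poly) gcomplex \<Rightarrow> int \<Rightarrow> ('b \<Rightarrow> 'c \<Rightarrow> 'r poly) \<Rightarrow> bool" where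
  "homological_degree C C' j f \<longleftrightarrow>
     (\<forall>a\<in>gens C. \<forall>b\<in>gens C'. f a b \<noteq> 0 \<longrightarrow> hdeg C' b = hdeg C a + j)"

definition quantum_degree ::
    "('b, 'r::comm_ring_1 poly) gcomplex \<Rightarrow> ('c, 'r poly) gcomplex \<Rightarrow> int \<Rightarrow> ('b \<Rightarrow> 'c \<Rightarrow> 'r poly) \<Rightarrow> bool" where
  "quantum_degree C C' k f \<longleftrightarrow>
     (\<forall>a\<in>gens C. \<forall>b\<in>gens C'. \<forall>m. coeff (f a b) m \<noteq> 0 \<longrightarrow>
        qdeg C' b - 2 * int m = qdeg C a + k)"

definition chain_map ::
    "('b, 'r::comm_ring_1 poly) gcomplex \<Rightarrow> ('c, 'r poly) gcomplex \<Rightarrow> ('b \<Rightarrow> 'c \<Rightarrow> 'r poly) \<Rightarrow> bool" where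
  "chain_map C C' f \<longleftrightarrow> homological_degree C C' 0 f \<and>
     (\<forall>a\<in>gens C. \<forall>b\<in>gens C'.
        compose_on (gens C') (dmat C') f a b = compose_on (gens C) f (dmat C) a b)"

definition homogeneous_chain_map ::
    "('b, 'r::comm_ring_1 poly) gcomplex \<Rightarrow> ('c, 'r poly) gcomplex \<Rightarrow> ('b \<Rightarrow> 'c \<Rightarrow> 'r poly) \<Rightarrow> bool" where
  "homogeneous_chain_map C C' f \<longleftrightarrow> chain_map C C' f \<and> (\<exists>k. quantum_degree C C' k f)"

text \<open>
  Homotopies are not required to be homogeneous in the quantum grading. If \<open>f\<close> and \<open>g\<close> are
  homogeneous of the same degree, one may pass to the homogeneous part of \<open>h\<close> of that degree.
\<close>

definition chain_homotopic :: "('b, 'r::comm_ring_1 poly) gcomplex \<Rightarrow> ('c, 'r poly) gcomplex \<Rightarrow>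
    ('b \<Rightarrow> 'c \<Rightarrow> 'r poly) \<Rightarrow> ('b \<Rightarrow> 'c \<Rightarrow> 'r poly) \<Rightarrow> bool" where
  "chain_homotopic C C' f g \<longleftrightarrow>
     (\<exists>h. homological_degree C C' (-1) h \<and>
        (\<forall>a\<in>gens C. \<forall>b\<in>gens C'.
           f a b - g a b =
             compose_on (gens C') (dmat C') h a b + compose_on (gens C) h (dmat C) a b))"

definition homotopy_equivalent ::
    "('b, 'r::comm_ring_1 poly) gcomplex \<Rightarrow> ('c, 'r poly) gcomplex \<Rightarrow> bool" where
  "homotopy_equivalent C C' \<longleftrightarrow>
     (\<exists>f g. chain_map C C' f \<and> quantum_degree C C' 0 f \<and>
            chain_map C' C g \<and> quantum_degree C' C 0 g \<and>
            chain_homotopic C C (compose_on (gens C') g f) (scalar_mat 1) \<and>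
            chain_homotopic C' C' (compose_on (gens C) f g) (scalar_mat 1))"

definition base_change :: "('b, int poly) gcomplex \<Rightarrow> ('b, 'r::comm_ring_1 poly) gcomplex" where
  "base_change C = \<lparr>gens = gens C, hdeg = hdeg C, qdeg = qdeg C,
     dmat = (\<lambda>a b. map_poly of_int (dmat C a b))\<rparr>"


section \<open>The complex CBN\<close>

text \<open>
  Cutting the knot at the basepoint and at all over- and underpasses gives arcs \<open>0, \<dots>, 2n\<close>: the
  passage at position \<open>i\<close> enters along arc \<open>i\<close> and leaves along arc \<open>i + 1\<close>, and the basepoint
  joins arc \<open>2n\<close> to arc \<open>0\<close>. A vertex of the cube is the set \<open>v\<close> of 1-smoothed crossings. The
  0-smoothing is the oriented one at a positive crossing, the 1-smoothing at a negative one.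
\<close>

definition joins :: "diagram \<Rightarrow> nat set \<Rightarrow> (nat \<times> nat) set" where
  "joins D v = {(0, 2 * length D)} \<union>
     (\<Union>i<length D. case D ! i of (p, r, \<epsilon>) \<Rightarrow>
        if \<epsilon> \<longleftrightarrow> i \<notin> v then {(p, r + 1), (r, p + 1)} else {(p, r), (p + 1, r + 1)})"

definition circles :: "diagram \<Rightarrow> nat set \<Rightarrow> nat set set" where
  "circles D v = {..2 * length D} // ((joins D v \<union> (joins D v)\<inverse>)\<^sup>*)"

definition free_circles :: "diagram \<Rightarrow> nat set \<Rightarrow> nat set set" where
  "free_circles D v = {c \<in> circles D v. 0 \<notin> c}"

text \<open>
  Structure constants of \<open>A = \<int>[G][X]/(X\<^sup>2 + GX)\<close> in the basis \<open>1, X\<close>. As \<open>A\<close> is commutative and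
  cocommutative, they depend only on the number \<open>k\<close> of factors \<open>X\<close> in the source and the number
  \<open>l\<close> of factors \<open>X\<close> in the target.
\<close>

definition merge_coeff :: "nat \<Rightarrow> nat \<Rightarrow> int poly" where
  "merge_coeff k l =
     (if (k, l) = (0, 0) \<or> (k, l) = (1, 1) then 1 else if (k, l) = (2, 1) then - G else 0)"

definition split_coeff :: "nat \<Rightarrow> nat \<Rightarrow> int poly" where
  "split_coeff k l =
     (if (k, l) = (0, 1) \<or> (k, l) = (1, 2) then 1 else if (k, l) = (0, 0) then G else 0)"

text \<open>
  A basis element of the cube is a pair \<open>(v, S)\<close>, where \<open>S\<close> is the set of circles labelled \<open>X\<close>. The
  circle through the basepoint carries the class of \<open>1\<close> in \<open>A/(X)\<close>, so it never lies in \<open>S\<close>; the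
  induced maps are the coefficients of \<open>m\<close> and \<open>\<Delta>\<close> between elements with that label \<open>1\<close>.
\<close>

definition edge_coeff :: "diagram \<Rightarrow> nat set \<times> nat set set \<Rightarrow> nat set \<times> nat set set \<Rightarrow> int poly" where
  "edge_coeff D = (\<lambda>(v, S) (w, T).
     let old = circles D v - circles D w; new = circles D w - circles D v
     in if S - old \<noteq> T - new then 0
        else if card old = 2 \<and> card new = 1 then merge_coeff (card (S \<inter> old)) (card (T \<inter> new))
        else if card old = 1 \<and> card new = 2 then split_coeff (card (S \<inter> old)) (card (T \<inter> new))
        else 0)"

definition n_plus :: "diagram \<Rightarrow> nat" where
  "n_plus D = length (filter (\<lambda>(p, r, \<epsilon>). \<epsilon>) D)"

definition n_minus :: "diagram \<Rightarrow> nat" where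
  "n_minus D = length (filter (\<lambda>(p, r, \<epsilon>). \<not> \<epsilon>) D)"

definition CBN :: "diagram \<Rightarrow> (nat set \<times> nat set set, int poly) gcomplex" where
  "CBN D = \<lparr>
     gens = {(v, S). v \<subseteq> {..<length D} \<and> S \<subseteq> free_circles D v},
     hdeg = (\<lambda>(v, S). int (card v) - int (n_minus D)),
     qdeg = (\<lambda>(v, S). int (card (free_circles D v - S)) - int (card S)
                      + int (card v) + int (n_plus D) - 2 * int (n_minus D)),
     dmat = (\<lambda>(v, S) (w, T).
       \<Sum>i | i < length D \<and> i \<notin> v \<and> w = insert i v.
         (-1) ^ card {j \<in> v. j < i} * edge_coeff D (v, S) (w, T))\<rparr>"

definition unknot_diagram :: diagram where
  "unknot_diagram = []"


section \<open>The Rasmussen invariant and \<open>\<lambda>\<close>\<close>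

text \<open>
  \<open>normal_form s ps\<close> is the sum of the tower \<open>t\<^sup>0 q\<^sup>s R[G]\<close> (generator \<open>None\<close>) and, for each entry
  \<open>(i, l, k)\<close> of \<open>ps\<close>, of \<open>t\<^sup>i q\<^sup>l R[G] \<longrightarrow> t\<^bsup>i+1\<^esup> q\<^bsup>2k+l\<^esup> R[G]\<close> with differential \<open>G\<^sup>k\<close>
  (generators \<open>Some (j, False)\<close> and \<open>Some (j, True)\<close> for the \<open>j\<close>-th entry).
\<close>

definition normal_form ::
    "int \<Rightarrow> (int \<times> int \<times> nat) list \<Rightarrow> ((nat \<times> bool) option, 'r::comm_ring_1 poly) gcomplex" where
  "normal_form s ps = \<lparr>
     gens = insert None (Some ` ({..<length ps} \<times> UNIV)),
     hdeg = (\<lambda>x. case x of None \<Rightarrow> 0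
               | Some (j, e) \<Rightarrow> (case ps ! j of (i, l, k) \<Rightarrow> if e then i + 1 else i)),
     qdeg = (\<lambda>x. case x of None \<Rightarrow> s
               | Some (j, e) \<Rightarrow> (case ps ! j of (i, l, k) \<Rightarrow> if e then 2 * int k + l else l)),
     dmat = (\<lambda>x y. case (x, y) of
                 (Some (j, False), Some (j', True)) \<Rightarrow>
                   if j = j' then (case ps ! j of (i, l, k) \<Rightarrow> G ^ k) else 0
               | _ \<Rightarrow> 0)\<rparr>"

text \<open>\<open>s\<close> is the Rasmussen invariant, over the field \<open>'f\<close>, of the knot with diagram \<open>D\<close>.\<close>

definition rasmussen_invariant :: "'f::field itself \<Rightarrow> diagram \<Rightarrow> int \<Rightarrow> bool" where
  "rasmussen_invariant F D s \<longleftrightarrow>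
     (\<exists>ps. (\<forall>(i, l, k) \<in> set ps. k \<ge> 1) \<and>
        homotopy_equivalent (base_change (CBN D) :: (_, 'f poly) gcomplex) (normal_form s ps))"

definition lambda_Z :: "diagram \<Rightarrow> diagram \<Rightarrow> enat" where
  "lambda_Z D D' = Inf {enat n | n.
     \<exists>f g. homogeneous_chain_map (CBN D) (CBN D') f \<and>
           homogeneous_chain_map (CBN D') (CBN D) g \<and>
           chain_homotopic (CBN D') (CBN D') (compose_on (gens (CBN D)) f g) (scalar_mat (G ^ n)) \<and>
           chain_homotopic (CBN D) (CBN D) (compose_on (gens (CBN D')) g f) (scalar_mat (G ^ n))}"

end

theory Submission imports Defs begin

text \<open>
  The complex of the unknot is a single copy of \<open>\<int>[G]\<close> in bidegree \<open>(0, 0)\<close>. Suppose that \<open>f\<close> and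
  \<open>g\<close> are homogeneous maps to and from this complex whose composites are homotopic to \<open>G\<^sup>n\<close>, and let
  \<open>a\<close> be the quantum degree of \<open>f\<close>; it is fixed before any field is chosen. The
  differential of \<open>\<int>[G]\<close> is zero, so homotopic endomorphisms of it are equal. Hence
  \<open>f \<circ> g = G\<^sup>n\<close> exactly, and this persists over \<open>\<F>[G]\<close> for every field \<open>\<F>\<close>.

  Over \<open>\<F>\<close>, transport \<open>f\<close> and \<open>g\<close> to the normal form. The identity \<open>f \<circ> g = G\<^sup>n\<close> survives, because
  \<open>f\<close> kills boundaries and \<open>g\<close> takes values in cycles (\<open>composite_through_equivalence\<close>). For the
  same two reasons the summands \<open>G\<^sup>k\<close> do not contribute to \<open>f \<circ> g\<close>
  (\<open>composite_through_normal_form\<close>): the source of such a summand contains no nonzero cycle, and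
  \<open>f\<close> vanishes on its target, as a multiple by \<open>G\<^sup>k\<close> of it is a boundary. So \<open>G\<^sup>n\<close> is the product of
  the two components at the tower \<open>q\<^sup>s \<F>[G]\<close>, whence the component of \<open>f\<close> is a nonzero scalar times
  \<open>G\<^sup>m\<close> with \<open>0 \<le> m \<le> n\<close>. Comparing quantum degrees gives \<open>s = - a - 2m\<close>. Thus \<open>s\<close> lies in the
  interval \<open>[- a - 2n, - a]\<close>, whatever the field is, and two points of it differ by at most \<open>2n\<close>.
\<close>

lemma compose_on_assoc:
  assumes "finite B" "finite C"
  shows "compose_on C h (compose_on B g f) = compose_on B (compose_on C h g) f"
proof (intro ext)
  fix a d
  have "(\<Sum>c\<in>C. (\<Sum>b\<in>B. f a b * g b c) * h c d) = (\<Sum>c\<in>C. \<Sum>b\<in>B. f a b * (g b c * h c d))"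
    by (simp add: sum_distrib_right mult.assoc)
  also have "\<dots> = (\<Sum>b\<in>B. f a b * (\<Sum>c\<in>C. g b c * h c d))"
    by (subst sum.swap) (simp add: sum_distrib_left)
  finally show "compose_on C h (compose_on B g f) a d = compose_on B (compose_on C h g) f a d"
    by (simp add: compose_on_def)
qed

lemma compose_on_cong:
  assumes "\<And>b. b \<in> B \<Longrightarrow> f a b = f' a b" "\<And>b. b \<in> B \<Longrightarrow> g b c = g' b c"
  shows "compose_on B g f a c = compose_on B g' f' a c"
  using assms by (simp add: compose_on_def cong: sum.cong)

lemma compose_on_zero_left:
  assumes "\<And>b. b \<in> B \<Longrightarrow> g b c = 0"
  shows "compose_on B g f a c = 0"
  using assms by (simp add: compose_on_def)

lemma compose_on_zero_right:
  assumes "\<And>b. b \<in> B \<Longrightarrow> f a b = 0"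
  shows "compose_on B g f a c = 0"
  using assms by (simp add: compose_on_def)

lemma compose_on_scalar_mat:
  assumes "finite B" "a \<in> B"
  shows "compose_on B g (scalar_mat x) a c = x * g a c"
proof -
  have "compose_on B g (scalar_mat x) a c = (\<Sum>b\<in>B. if a = b then x * g a c else 0)"
    unfolding compose_on_def scalar_mat_def by (intro sum.cong) auto
  with assms show ?thesis by simp
qed

lemma quantum_degree_compose_on:
  assumes f: "quantum_degree A B j f" and g: "quantum_degree B C k g"
  shows "quantum_degree A C (j + k) (compose_on (gens B) g f)"
  unfolding quantum_degree_def
proof (intro ballI allI impI)
  fix a c m
  assume a: "a \<in> gens A" and c: "c \<in> gens C"
    and "coeff (compose_on (gens B) g f a c) m \<noteq> 0"
  then have "(\<Sum>b\<in>gens B. coeff (f a b * g b c) m) \<noteq> 0"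
    by (simp add: compose_on_def coeff_sum)
  then obtain b where b: "b \<in> gens B" "coeff (f a b * g b c) m \<noteq> 0"
    by (meson sum.neutral)
  then obtain i where i: "i \<le> m" "coeff (f a b) i * coeff (g b c) (m - i) \<noteq> 0"
    unfolding coeff_mult by (metis (no_types, lifting) atMost_iff sum.neutral)
  then have "coeff (f a b) i \<noteq> 0" "coeff (g b c) (m - i) \<noteq> 0"
    by auto
  then have "qdeg B b - 2 * int i = qdeg A a + j" "qdeg C c - 2 * int (m - i) = qdeg B b + k"
    using f g a b(1) c unfolding quantum_degree_def by blast+
  with i(1) show "qdeg C c - 2 * int m = qdeg A a + (j + k)"
    by (simp add: of_nat_diff)
qed


section \<open>Maps to and from a complex without differential\<close>

text \<open>
  Below, \<open>f\<close> and \<open>g\<close> are maps to and from a free module of rank one, with generator \<open>u\<close>, in which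
  the differential is zero. Being chain maps then means that \<open>f\<close> kills boundaries and that \<open>g\<close> takes
  values in cycles.
\<close>

text \<open>
  With \<open>\<psi> \<circ> \<phi> = 1 + dh + hd\<close>, the two error terms in \<open>f \<circ> \<psi> \<circ> \<phi> \<circ> g\<close> contain \<open>f \<circ> d = 0\<close> and
  \<open>d \<circ> g = 0\<close>.
\<close>
lemma composite_through_equivalence:
  assumes fin: "finite (gens C)" "finite (gens N)"
    and htpy: "chain_homotopic C C (compose_on (gens N) \<psi> \<phi>) (scalar_mat 1)"
    and fd: "\<And>x. x \<in> gens C \<Longrightarrow> compose_on (gens C) f (dmat C) x u = 0"
    and dg: "\<And>x. x \<in> gens C \<Longrightarrow> compose_on (gens C) (dmat C) g u x = 0"
  shows "compose_on (gens N) (compose_on (gens C) f \<psi>) (compose_on (gens C) \<phi> g) u u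
    = compose_on (gens C) f g u u"
proof -
  let ?B = "gens C" and ?d = "dmat C"
  obtain h where h: "\<And>x y. x \<in> ?B \<Longrightarrow> y \<in> ?B \<Longrightarrow>
      compose_on (gens N) \<psi> \<phi> x y
        = scalar_mat 1 x y + (compose_on ?B ?d h x y + compose_on ?B h ?d x y)"
    using htpy unfolding chain_homotopic_def by (metis add.commute diff_eq_eq)
  have fdh: "compose_on ?B f (compose_on ?B ?d h) x u = 0" for x
    by (simp add: compose_on_assoc fin compose_on_zero_left fd)
  have dhg: "compose_on ?B f (compose_on ?B (compose_on ?B h ?d) g) u u = 0"
  proof (rule compose_on_zero_right)
    fix y
    have "compose_on ?B (compose_on ?B h ?d) g u y = compose_on ?B h (compose_on ?B ?d g) u y"
      by (simp add: compose_on_assoc fin)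
    then show "compose_on ?B (compose_on ?B h ?d) g u y = 0"
      by (simp add: compose_on_zero_right dg)
  qed
  have "compose_on (gens N) (compose_on ?B f \<psi>) (compose_on ?B \<phi> g) u u
      = compose_on ?B (compose_on ?B f (compose_on (gens N) \<psi> \<phi>)) g u u"
    by (simp add: compose_on_assoc fin)
  also have "\<dots> = compose_on ?B (\<lambda>x w. compose_on ?B f (scalar_mat 1) x w
      + (compose_on ?B f (compose_on ?B ?d h) x w + compose_on ?B f (compose_on ?B h ?d) x w)) g u u"
  proof (rule compose_on_cong)
    fix x assume x: "x \<in> ?B"
    show "compose_on ?B f (compose_on (gens N) \<psi> \<phi>) x u = compose_on ?B f (scalar_mat 1) x u
        + (compose_on ?B f (compose_on ?B ?d h) x u + compose_on ?B f (compose_on ?B h ?d) x u)"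
      unfolding compose_on_def[of ?B f] sum.distrib[symmetric] distrib_right[symmetric]
      by (intro sum.cong refl) (simp add: h x)
  qed simp
  also have "\<dots> = compose_on ?B f g u u + compose_on ?B (compose_on ?B f (compose_on ?B h ?d)) g u u"
    unfolding fdh compose_on_def[of ?B _ g]
    by (simp add: distrib_left sum.distrib compose_on_scalar_mat fin)
  also have "compose_on ?B (compose_on ?B f (compose_on ?B h ?d)) g u u = 0"
    using dhg by (simp add: compose_on_assoc fin)
  finally show ?thesis by simp
qed

lemma finite_gens_normal_form: "finite (gens (normal_form s ps))"
  by (simp add: normal_form_def)

lemma G_eq_monom: "(G :: 'r::comm_ring_1 poly) = monom 1 1"
  by (simp add: G_def monom_altdef)

lemma G_power_eq_monom: "(G :: 'r::comm_ring_1 poly) ^ k = monom 1 k"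
  by (simp add: G_eq_monom monom_power)

text \<open>
  Multiplication by \<open>G\<^sup>k\<close> is injective. Hence \<open>d \<circ> g = 0\<close> forces the components of \<open>g\<close> at the sources
  of the torsion summands to vanish, and \<open>f \<circ> d = 0\<close> those of \<open>f\<close> at the targets.
\<close>
lemma composite_through_normal_form:
  fixes f :: "(nat \<times> bool) option \<Rightarrow> 'c \<Rightarrow> 'f::field poly"
    and s :: int and ps :: "(int \<times> int \<times> nat) list"
  defines "N \<equiv> normal_form s ps"
  assumes fd: "\<And>x. x \<in> gens N \<Longrightarrow> compose_on (gens N) f (dmat N) x u = 0"
    and dg: "\<And>x. x \<in> gens N \<Longrightarrow> compose_on (gens N) (dmat N) g u x = 0"
  shows "compose_on (gens N) f g u u = g u None * f None u"
proof -
  have fin: "finite (gens N)"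
    by (simp add: N_def finite_gens_normal_form)
  have torsion: "g u x * f x u = 0" if x: "x \<in> gens N" "x \<noteq> None" for x
  proof -
    obtain j e where je: "x = Some (j, e)" using x(2) by (cases x) auto
    then have gen: "Some (j, e') \<in> gens N" for e'
      using x(1) by (auto simp: N_def normal_form_def)
    obtain i l k where ps: "ps ! j = (i, l, k)" by (cases "ps ! j")
    show ?thesis
    proof (cases e)
      case False
      have "compose_on (gens N) (dmat N) g u (Some (j, True))
          = (\<Sum>y\<in>gens N. if y = Some (j, False) then g u y * G ^ k else 0)"
        unfolding compose_on_def N_def normal_form_def
        by (intro sum.cong) (auto simp: ps split: option.splits bool.splits)
      then have "g u (Some (j, False)) * G ^ k = 0"
        using dg[OF gen] fin gen by simp
      with False show ?thesis by (simp add: je G_power_eq_monom)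
    next
      case True
      have "compose_on (gens N) f (dmat N) (Some (j, False)) u
          = (\<Sum>y\<in>gens N. if y = Some (j, True) then G ^ k * f y u else 0)"
        unfolding compose_on_def N_def normal_form_def
        by (intro sum.cong) (auto simp: ps split: option.splits bool.splits)
      then have "G ^ k * f (Some (j, True)) u = 0"
        using fd[OF gen] fin gen by simp
      with True show ?thesis by (simp add: je G_power_eq_monom)
    qed
  qed
  have "None \<in> gens N" by (simp add: N_def normal_form_def)
  then have "compose_on (gens N) f g u u = g u None * f None u + (\<Sum>x\<in>gens N - {None}. g u x * f x u)"
    unfolding compose_on_def by (simp add: sum.remove fin)
  moreover have "(\<Sum>x\<in>gens N - {None}. g u x * f x u) = 0"
    by (rule sum.neutral) (use torsion in blast)
  ultimately show ?thesis by simp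
qed

text \<open>
  The exponent \<open>m\<close> is the power of \<open>G\<close> by which \<open>f\<close> maps the tower to \<open>\<F>[G]\<close>; it is at most \<open>n\<close>
  because that power divides \<open>G\<^sup>n\<close>.
\<close>
lemma tower_degree:
  fixes C :: "('b, 'f::field poly) gcomplex" and U :: "('c, 'f poly) gcomplex"
  assumes fin: "finite (gens C)"
    and equiv: "homotopy_equivalent C (normal_form s ps)"
    and U: "gens U = {u}" "dmat U u u = 0" "qdeg U u = 0"
    and f: "chain_map C U f" "quantum_degree C U a f"
    and g: "chain_map U C g"
    and fg: "compose_on (gens C) f g u u = G ^ n"
  obtains m where "m \<le> n" "s = - a - 2 * int m"
proof -
  define N where "N = (normal_form s ps :: (_, 'f poly) gcomplex)"
  have finN: "finite (gens N)" by (simp add: N_def finite_gens_normal_form)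
  obtain \<phi> \<psi> where \<phi>: "chain_map C N \<phi>"
    and \<psi>: "chain_map N C \<psi>" "quantum_degree N C 0 \<psi>"
    and htpy: "chain_homotopic C C (compose_on (gens N) \<psi> \<phi>) (scalar_mat 1)"
    using equiv unfolding homotopy_equivalent_def N_def[symmetric] by blast
  define f' g' where "f' = compose_on (gens C) f \<psi>" and "g' = compose_on (gens C) \<phi> g"
  have fd: "compose_on (gens C) f (dmat C) x u = 0" if "x \<in> gens C" for x
  proof -
    have "compose_on (gens C) f (dmat C) x u = compose_on (gens U) (dmat U) f x u"
      using f(1) that U(1) by (simp add: chain_map_def)
    also have "\<dots> = 0" using U by (simp add: compose_on_def)
    finally show ?thesis .
  qed
  have dg: "compose_on (gens C) (dmat C) g u x = 0" if "x \<in> gens C" for x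
  proof -
    have "compose_on (gens C) (dmat C) g u x = compose_on (gens U) g (dmat U) u x"
      using g that U(1) by (simp add: chain_map_def)
    also have "\<dots> = 0" using U by (simp add: compose_on_def)
    finally show ?thesis .
  qed
  have f'd: "compose_on (gens N) f' (dmat N) x u = 0" if x: "x \<in> gens N" for x
  proof -
    have "compose_on (gens N) f' (dmat N) x u
        = compose_on (gens C) f (compose_on (gens N) \<psi> (dmat N)) x u"
      by (simp add: f'_def compose_on_assoc fin finN)
    also have "\<dots> = compose_on (gens C) f (compose_on (gens C) (dmat C) \<psi>) x u"
      using \<psi>(1) x by (intro compose_on_cong) (auto simp: chain_map_def)
    also have "\<dots> = 0"
      by (simp add: compose_on_assoc fin compose_on_zero_left fd)
    finally show ?thesis .
  qed
  have dg': "compose_on (gens N) (dmat N) g' u x = 0" if x: "x \<in> gens N" for x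
  proof -
    have "compose_on (gens N) (dmat N) g' u x
        = compose_on (gens C) (compose_on (gens N) (dmat N) \<phi>) g u x"
      by (simp add: g'_def compose_on_assoc fin finN)
    also have "\<dots> = compose_on (gens C) (compose_on (gens C) \<phi> (dmat C)) g u x"
      using \<phi> x by (intro compose_on_cong) (auto simp: chain_map_def)
    also have "\<dots> = compose_on (gens C) \<phi> (compose_on (gens C) (dmat C) g) u x"
      by (simp add: compose_on_assoc fin)
    also have "\<dots> = 0"
      by (simp add: compose_on_zero_right dg)
    finally show ?thesis .
  qed
  have "compose_on (gens N) f' g' u u = G ^ n"
    unfolding f'_def g'_def using composite_through_equivalence[OF fin finN htpy fd dg] fg by simp
  moreover have "compose_on (gens N) f' g' u u = g' u None * f' None u"
    using f'd dg' unfolding N_def by (rule composite_through_normal_form)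
  ultimately have prod: "g' u None * f' None u = monom 1 n"
    by (simp add: G_power_eq_monom)
  then have nz: "g' u None \<noteq> 0" "f' None u \<noteq> 0"
    by (metis monom_eq_0_iff mult_zero_left mult_zero_right one_neq_zero)+
  define m where "m = degree (f' None u)"
  have "degree (g' u None) + m = n"
    using arg_cong[OF prod, of degree] nz by (simp add: m_def degree_mult_eq degree_monom_eq)
  then have "m \<le> n" by simp
  moreover have "s = - a - 2 * int m"
  proof -
    have "quantum_degree N U (0 + a) f'"
      unfolding f'_def using \<psi>(2) f(2) by (rule quantum_degree_compose_on)
    moreover have "coeff (f' None u) m \<noteq> 0" using nz(2) by (simp add: m_def)
    moreover have "None \<in> gens N" "qdeg N None = s" by (simp_all add: N_def normal_form_def)
    ultimately have "0 - 2 * int m = s + (0 + a)"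
      using U unfolding quantum_degree_def by (metis singletonI)
    then show ?thesis by simp
  qed
  ultimately show ?thesis by (rule that)
qed


section \<open>Base change\<close>

lemma map_poly_of_int_sum:
  "map_poly of_int (\<Sum>x\<in>A. p x) = (\<Sum>x\<in>A. map_poly of_int (p x) :: 'r::comm_ring_1 poly)"
  by (rule poly_eqI) (simp add: coeff_map_poly coeff_sum)

lemma map_poly_of_int_mult:
  "map_poly of_int (p * q) = (map_poly of_int p * map_poly of_int q :: 'r::comm_ring_1 poly)"
  by (rule poly_eqI) (simp add: coeff_map_poly coeff_mult)

lemma map_poly_of_int_G_power: "map_poly of_int (G ^ n) = (G ^ n :: 'r::comm_ring_1 poly)"
  by (simp add: G_power_eq_monom map_poly_monom)

lemma compose_on_map_poly_of_int:
  "compose_on B (\<lambda>b c. map_poly of_int (g b c)) (\<lambda>a b. map_poly of_int (f a b))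
    = (\<lambda>a c. map_poly of_int (compose_on B g f a c) :: 'r::comm_ring_1 poly)"
  by (simp add: compose_on_def map_poly_of_int_sum map_poly_of_int_mult)

lemma chain_map_base_change:
  assumes "chain_map C C' f"
  shows "chain_map (base_change C) (base_change C')
    (\<lambda>a b. map_poly of_int (f a b) :: 'r::comm_ring_1 poly)"
  using assms unfolding chain_map_def homological_degree_def
  by (auto simp: base_change_def compose_on_map_poly_of_int) (metis map_poly_0)

lemma quantum_degree_base_change:
  assumes "quantum_degree C C' k f"
  shows "quantum_degree (base_change C) (base_change C') k
    (\<lambda>a b. map_poly of_int (f a b) :: 'r::comm_ring_1 poly)"
  using assms unfolding quantum_degree_def
  by (auto simp: base_change_def coeff_map_poly) (metis of_int_0)


section \<open>The Rasmussen invariants\<close>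

lemma finite_gens_CBN: "finite (gens (CBN D))"
proof -
  have "finite (circles D v)" for v
    unfolding circles_def quotient_def by simp
  then have "finite (free_circles D v)" for v
    by (simp add: free_circles_def)
  moreover have "gens (CBN D) = Sigma (Pow {..<length D}) (\<lambda>v. Pow (free_circles D v))"
    by (auto simp: CBN_def)
  ultimately show ?thesis by simp
qed

lemma unknot_no_free_circles: "free_circles unknot_diagram {} = {}"
  by (auto simp: free_circles_def circles_def unknot_diagram_def quotient_def)

lemma CBN_unknot:
  shows "gens (CBN unknot_diagram) = {({}, {})}"
    and "dmat (CBN unknot_diagram) x y = 0"
    and "qdeg (CBN unknot_diagram) ({}, {}) = 0"
  using unknot_no_free_circles
  by (auto simp: CBN_def unknot_diagram_def n_plus_def n_minus_def split: prod.splits)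

text \<open>
  The interval depends only on the integral map \<open>f\<close> and on \<open>n\<close>, so it is the same for all fields.
\<close>
lemma rasmussen_invariant_bounds:
  assumes ras: "rasmussen_invariant TYPE('f::field) D s"
    and f: "chain_map (CBN D) (CBN unknot_diagram) f"
      "quantum_degree (CBN D) (CBN unknot_diagram) a f"
    and g: "chain_map (CBN unknot_diagram) (CBN D) g"
    and fg: "chain_homotopic (CBN unknot_diagram) (CBN unknot_diagram)
      (compose_on (gens (CBN D)) f g) (scalar_mat (G ^ n))"
  shows "s \<in> {- a - 2 * int n .. - a}"
proof -
  let ?C = "base_change (CBN D) :: (_, 'f poly) gcomplex"
  let ?U = "base_change (CBN unknot_diagram) :: (_, 'f poly) gcomplex"
  let ?u = "({}, {}) :: nat set \<times> nat set set"
  let ?f = "\<lambda>a b. map_poly of_int (f a b) :: 'f poly"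
  let ?g = "\<lambda>a b. map_poly of_int (g a b) :: 'f poly"
  obtain ps where equiv: "homotopy_equivalent ?C (normal_form s ps)"
    using ras unfolding rasmussen_invariant_def by blast
  have "compose_on (gens (CBN D)) f g ?u ?u = G ^ n"
    using fg unfolding chain_homotopic_def
    by (simp add: CBN_unknot compose_on_def scalar_mat_def)
  then have fg': "compose_on (gens ?C) ?f ?g ?u ?u = G ^ n"
    by (simp add: base_change_def compose_on_map_poly_of_int map_poly_of_int_G_power)
  have "finite (gens ?C)" "gens ?U = {?u}" "dmat ?U ?u ?u = 0" "qdeg ?U ?u = 0"
    by (simp_all add: base_change_def finite_gens_CBN CBN_unknot)
  then obtain m where "m \<le> n" "s = - a - 2 * int m"
    using tower_degree[OF _ equiv _ _ _ chain_map_base_change[OF f(1)]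
        quantum_degree_base_change[OF f(2)] chain_map_base_change[OF g] fg'] by blast
  then show ?thesis by simp
qed

theorem corollary3p27:
  fixes K :: "real \<Rightarrow> real^4" and D :: diagram and s s' :: int
  assumes "smooth_knot K"
    and "diagram_of K D"
    and "rasmussen_invariant TYPE('f::field) D s"
    and "rasmussen_invariant TYPE('g::field) D s'"
  shows "enat (nat \<bar>s - s'\<bar>) \<le> 2 * lambda_Z D unknot_diagram"
proof -
  define E where "E = {enat n | n.
     \<exists>f g. homogeneous_chain_map (CBN D) (CBN unknot_diagram) f \<and>
           homogeneous_chain_map (CBN unknot_diagram) (CBN D) g \<and>
           chain_homotopic (CBN unknot_diagram) (CBN unknot_diagram)
             (compose_on (gens (CBN D)) f g) (scalar_mat (G ^ n)) \<and>
           chain_homotopic (CBN D) (CBN D)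
             (compose_on (gens (CBN unknot_diagram)) g f) (scalar_mat (G ^ n))}"
  have lam: "lambda_Z D unknot_diagram = Inf E"
    by (simp add: lambda_Z_def E_def)
  show ?thesis
  proof (cases "E = {}")
    case True
    then show ?thesis
      unfolding lam by (simp add: Inf_enat_def numeral_eq_enat)
  next
    case False
    then have "Inf E \<in> E" by (meson ex_in_conv wellorder_InfI)
    then obtain n f g a where n: "Inf E = enat n"
      and f: "chain_map (CBN D) (CBN unknot_diagram) f"
        "quantum_degree (CBN D) (CBN unknot_diagram) a f"
      and g: "chain_map (CBN unknot_diagram) (CBN D) g"
      and fg: "chain_homotopic (CBN unknot_diagram) (CBN unknot_diagram)
        (compose_on (gens (CBN D)) f g) (scalar_mat (G ^ n))"
      unfolding E_def homogeneous_chain_map_def by blast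
    have "s \<in> {- a - 2 * int n .. - a}" "s' \<in> {- a - 2 * int n .. - a}"
      using rasmussen_invariant_bounds[OF _ f g fg] assms(3,4) by blast+
    then have "nat \<bar>s - s'\<bar> \<le> 2 * n" by auto
    then show ?thesis
      unfolding lam n by (simp add: numeral_eq_enat)
  qed
qed

end
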